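(* Let $a,b\ge1$ be integers such that none of the sets $P_{a,b}$, $\mathrm{Free}^\infty(\mathbb{T}^a,\mathbb{R}^{q_a})$, $\mathrm{Free}^\infty(\mathbb{T}^b,\mathbb{R}^{q_b})$ is empty. Let $f\in\mathrm{Free}^\infty(\mathbb{T}^a,\mathbb{R}^{q_a})$, $g\in\mathrm{Free}^\infty(\mathbb{T}^b,\mathbb{R}^{q_b})$ and $h\in P_{a,b}$, and set $$F:\mathbb{T}^{a+b}=\mathbb{T}^a\times\mathbb{T}^b\to\mathbb{R}^{q_{a+b}}=\mathbb{R}^{q_a}\oplus\mathbb{R}^{q_b}\oplus\mathbb{R}^{ab},\qquad F(x,y)=\bigl(f(x),\,g(y),\,h(x,y)\bigr).$$ Then $F\in\mathrm{Free}^\infty(\mathbb{T}^{a+b},\mathbb{R}^{q_{a+b}})$.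
   Context: $\mathbb{T}^m=\mathbb{R}^m/2\pi\mathbb{Z}^m$ with its flat coordinates, and $q_m=m(m+3)/2$ (so that $q_{a+b}=q_a+q_b+ab$). A $C^2$ map $f:\mathbb{T}^m\to\mathbb{R}^q$ is free if the $q_m$ vectors $\partial_\alpha f$ ($1\le\alpha\le m$) and $\partial_\alpha\partial_\beta f$ ($1\le\alpha\le\beta\le m$) are linearly independent at every point. $\mathrm{Free}^\infty(\mathbb{T}^m,\mathbb{R}^q)$ denotes the set of $C^\infty$ free maps $\mathbb{T}^m\to\mathbb{R}^q$. A $C^\infty$ map $h:\mathbb{T}^a\times\mathbb{T}^b\to\mathbb{R}^{ab}$, $(x,y)\mapsto h(x,y)$, is cross-free if its mixed Hessian, the linear map $H_h(x,y):\mathbb{R}^a\otimes\mathbb{R}^b\to\mathbb{R}^{ab}$, $e_i\otimes e_\alpha\mapsto\frac{\partial^2h}{\partial x^i\partial y^\alpha}(x,y)$, is invertible at every point $(x,y)$. $P_{a,b}$ denotes the set of all cross-free maps on $\mathbb{T}^a\times\mathbb{T}^b$. *)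

theory Defs
  imports "HOL-Analysis.Analysis"
begin

definition torus_rel :: "real ^ 'm \<Rightarrow> real ^ 'm \<Rightarrow> bool"
  where "torus_rel x y \<longleftrightarrow> (\<forall>i. \<exists>k::int. y $ i = x $ i + 2 * pi * of_int k)"

lemma equivp_torus_rel: "equivp (torus_rel :: real ^ 'm \<Rightarrow> _)"
proof (rule equivpI)
  show "reflp (torus_rel :: real ^ 'm \<Rightarrow> _)"
    unfolding reflp_def torus_rel_def by (metis add_0_right mult_zero_right of_int_0)
  show "symp (torus_rel :: real ^ 'm \<Rightarrow> _)"
  proof (rule sympI)
    fix x y :: "real ^ 'm" assume "torus_rel x y"
    show "torus_rel y x"
      unfolding torus_rel_def
    proof
      fix i
      from \<open>torus_rel x y\<close> obtain k :: int where "y $ i = x $ i + 2 * pi * of_int k"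
        unfolding torus_rel_def by blast
      then have "x $ i = y $ i + 2 * pi * of_int (- k)" by simp
      then show "\<exists>k::int. x $ i = y $ i + 2 * pi * of_int k" by blast
    qed
  qed
  show "transp (torus_rel :: real ^ 'm \<Rightarrow> _)"
  proof (rule transpI)
    fix x y z :: "real ^ 'm" assume *: "torus_rel x y" "torus_rel y z"
    show "torus_rel x z"
      unfolding torus_rel_def
    proof
      fix i
      from * obtain k l :: int where "y $ i = x $ i + 2 * pi * of_int k"
          and "z $ i = y $ i + 2 * pi * of_int l"
        unfolding torus_rel_def by blast
      then have "z $ i = x $ i + 2 * pi * of_int (k + l)" by (simp add: algebra_simps)
      then show "\<exists>k::int. z $ i = x $ i + 2 * pi * of_int k" by blast
    qed
  qed
qed

quotient_type (overloaded) 'm torus = "real ^ ('m::finite)" / torus_rel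
  morphisms rep_torus torus_proj
  by (rule equivp_torus_rel)

definition vec_join :: "'c ^ 'a \<Rightarrow> 'c ^ 'b \<Rightarrow> 'c ^ ('a + 'b)"
  where "vec_join u v = (\<chi> k. case k of Inl i \<Rightarrow> u $ i | Inr j \<Rightarrow> v $ j)"

lift_definition torus_join :: "'a::finite torus \<Rightarrow> 'b::finite torus \<Rightarrow> ('a + 'b) torus"
  is vec_join
  by (auto simp: torus_rel_def vec_join_def split: sum.splits)

lemma bij_torus_join:
  "bij (\<lambda>(x, y). torus_join x y :: ('a::finite + 'b::finite) torus)"
proof (rule bijI)
  show "inj (\<lambda>(x, y). torus_join x y :: ('a + 'b) torus)"
  proof (clarsimp simp: inj_def)
    fix x x' :: "'a torus" and y y' :: "'b torus"
    assume "torus_join x y = torus_join x' y'"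
    then show "x = x' \<and> y = y'"
    proof transfer
      fix x x' :: "real ^ 'a" and y y' :: "real ^ 'b"
      assume "torus_rel (vec_join x y) (vec_join x' y')"
      then have "\<exists>n::int. (case k of Inl i \<Rightarrow> x' $ i | Inr j \<Rightarrow> y' $ j) =
          (case k of Inl i \<Rightarrow> x $ i | Inr j \<Rightarrow> y $ j) + 2 * pi * of_int n" for k
        by (simp add: torus_rel_def vec_join_def)
      from this[of "Inl _"] this[of "Inr _"]
      show "torus_rel x x' \<and> torus_rel y y'"
        by (simp add: torus_rel_def)
    qed
  qed
  show "surj (\<lambda>(x, y). torus_join x y :: ('a + 'b) torus)"
  proof (rule surjI)
    fix z :: "('a + 'b) torus"
    let ?r = "rep_torus z"
    have "vec_join (\<chi> i. ?r $ Inl i) (\<chi> j. ?r $ Inr j) = ?r"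
      by (simp add: vec_join_def vec_eq_iff split: sum.splits)
    then show "(\<lambda>(x, y). torus_join x y)
        ((\<lambda>z. (torus_proj (\<chi> i. rep_torus z $ Inl i), torus_proj (\<chi> j. rep_torus z $ Inr j))) z) = z"
      using Quotient_abs_rep[OF Quotient_torus, of z] by (simp add: torus_join.abs_eq)
  qed
qed

text \<open>Meaningful only where \<open>f\<close> is differentiable; every use below is on functions that are
  also required to be sufficiently smooth.\<close>

definition dir_deriv ::
    "'v::real_normed_vector \<Rightarrow> ('v \<Rightarrow> 'w::real_normed_vector) \<Rightarrow> 'v \<Rightarrow> 'w"
  where "dir_deriv v f x = frechet_derivative f (at x) v"

fun C_k :: "nat \<Rightarrow> ('v::euclidean_space \<Rightarrow> 'w::real_normed_vector) \<Rightarrow> bool"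
  where
    "C_k 0 f \<longleftrightarrow> continuous_on UNIV f"
  | "C_k (Suc k) f \<longleftrightarrow> (\<forall>x. f differentiable (at x)) \<and> (\<forall>e\<in>Basis. C_k k (dir_deriv e f))"

definition C_infinity :: "('v::euclidean_space \<Rightarrow> 'w::real_normed_vector) \<Rightarrow> bool"
  where "C_infinity f \<longleftrightarrow> (\<forall>k. C_k k f)"

text \<open>A map on a torus (or on a product of two tori) is differentiated through its periodic
  lift to the universal cover, that is, in the flat coordinates.\<close>

definition torus_lift :: "('m::finite torus \<Rightarrow> 'w) \<Rightarrow> real ^ 'm \<Rightarrow> 'w"
  where "torus_lift f x = f (torus_proj x)"

definition torus_lift2 ::
    "('a::finite torus \<times> 'b::finite torus \<Rightarrow> 'w) \<Rightarrow> (real ^ 'a) \<times> (real ^ 'b) \<Rightarrow> 'w"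
  where "torus_lift2 h = (\<lambda>(x, y). h (torus_proj x, torus_proj y))"

definition q_dim :: "nat \<Rightarrow> nat"
  where "q_dim m = m * (m + 3) div 2"

text \<open>The ordered index type makes sense of the condition \<open>\<alpha> \<le> \<beta>\<close> on second-order
  indices; on a disjoint sum the indices of the first summand come first.\<close>

instantiation sum :: (linorder, linorder) linorder
begin

definition less_eq_sum :: "'a + 'b \<Rightarrow> 'a + 'b \<Rightarrow> bool"
  where "less_eq_sum s t = (case s of
      Inl i \<Rightarrow> (case t of Inl i' \<Rightarrow> i \<le> i' | Inr _ \<Rightarrow> True)
    | Inr j \<Rightarrow> (case t of Inl _ \<Rightarrow> False | Inr j' \<Rightarrow> j \<le> j'))"

definition less_sum :: "'a + 'b \<Rightarrow> 'a + 'b \<Rightarrow> bool"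
  where "less_sum s t \<longleftrightarrow> s \<le> t \<and> \<not> t \<le> s"

instance
  by standard (auto simp: less_sum_def less_eq_sum_def split: sum.splits)

end

text \<open>Independence of the set \<open>v ` I\<close> alone would ignore repetitions in the family.\<close>

definition lin_indep_family :: "'i set \<Rightarrow> ('i \<Rightarrow> 'v::real_vector) \<Rightarrow> bool"
  where "lin_indep_family I v \<longleftrightarrow> inj_on v I \<and> independent (v ` I)"

definition jet_index :: "('m + 'm \<times> 'm::linorder) set"
  where "jet_index = range Inl \<union> Inr ` {(\<alpha>, \<beta>). \<alpha> \<le> \<beta>}"

definition jet ::
    "(real ^ 'm \<Rightarrow> real ^ 'q) \<Rightarrow> real ^ 'm \<Rightarrow> 'm + 'm \<times> 'm \<Rightarrow> real ^ 'q"
  where "jet f x k = (case k of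
      Inl \<alpha> \<Rightarrow> dir_deriv (axis \<alpha> 1) f x
    | Inr (\<alpha>, \<beta>) \<Rightarrow> dir_deriv (axis \<alpha> 1) (dir_deriv (axis \<beta> 1) f) x)"

definition free_map :: "('m::{finite,linorder} torus \<Rightarrow> real ^ 'q) \<Rightarrow> bool"
  where "free_map f \<longleftrightarrow> C_k 2 (torus_lift f) \<and>
    (\<forall>x. lin_indep_family jet_index (jet (torus_lift f) x))"

definition Free_infinity :: "('m::{finite,linorder} torus \<Rightarrow> real ^ 'q) set"
  where "Free_infinity = {f. C_infinity (torus_lift f) \<and> free_map f}"

text \<open>The tensor product of \<open>real ^ 'a\<close> and \<open>real ^ 'b\<close> is \<open>real ^ ('a \<times> 'b)\<close>, where
  \<open>axis (i, \<alpha>) 1\<close> is the elementary tensor of the standard basis vectors \<open>axis i 1\<close> and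
  \<open>axis \<alpha> 1\<close>.\<close>

definition mixed_hessian ::
    "((real ^ 'a) \<times> (real ^ 'b) \<Rightarrow> real ^ 'r) \<Rightarrow> (real ^ 'a) \<times> (real ^ 'b)
      \<Rightarrow> real ^ ('a \<times> 'b) \<Rightarrow> real ^ 'r"
  where "mixed_hessian h p w = (\<Sum>(i, \<alpha>)\<in>UNIV.
    w $ (i, \<alpha>) *\<^sub>R dir_deriv (axis i 1, 0) (dir_deriv (0, axis \<alpha> 1) h) p)"

definition cross_free_maps :: "('a::finite torus \<times> 'b::finite torus \<Rightarrow> real ^ 'r) set"
  where "cross_free_maps = {h. C_infinity (torus_lift2 h) \<and>
    (\<forall>p. bij (mixed_hessian (torus_lift2 h) p))}"

end

theory Submission imports Defs begin

text \<open>
  In flat coordinates \<open>z = (x, y)\<close> the lift of \<open>F\<close> is the map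
  \<open>(f x, g y, h (x, y))\<close>. A map of this shape keeps the shape under differentiation: along
  \<open>(u, v)\<close> its derivative is \<open>(\<partial>\<^sub>u f x, \<partial>\<^sub>v g y, \<partial>\<^sub>(\<^sub>u\<^sub>,\<^sub>v\<^sub>) h (x, y))\<close>
  (\<open>dir_deriv_block_map\<close>). Smoothness of \<open>F\<close> follows by induction on the order
  (\<open>C_k_block_map\<close>), and iterating the rule twice gives the 2-jet of \<open>F\<close>. Sorted by type of
  derivative, the jet vectors form a block matrix:

    \<^item> the pure \<open>x\<close>-derivatives have \<open>f\<close>-component the corresponding jet vector of \<open>f\<close>
      and vanishing \<open>g\<close>-component;
    \<^item> the pure \<open>y\<close>-derivatives have \<open>g\<close>-component the corresponding jet vector of \<open>g\<close>
      and vanishing \<open>f\<close>-component;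
    \<^item> the mixed derivatives \<open>\<partial>\<^sub>x\<partial>\<^sub>y\<close> are concentrated in the \<open>h\<close>-component, where they
      are the columns of the mixed Hessian.

  This matrix is block triangular. Hence a vanishing linear combination of jet vectors of \<open>F\<close> is
  resolved one block at a time (\<open>lin_indep_jet_block_map\<close>): the \<open>f\<close>-component kills the
  coefficients of the pure \<open>x\<close>-derivatives because \<open>f\<close> is free, the \<open>g\<close>-component those of the
  pure \<open>y\<close>-derivatives because \<open>g\<close> is free, and what is left in the \<open>h\<close>-component is the mixed
  Hessian applied to the remaining coefficients, which vanish because the mixed Hessian is injective.
\<close>

section \<open>Splitting and joining coordinate vectors\<close>

definition vec_left :: "'c ^ ('a::finite + 'b::finite) \<Rightarrow> 'c ^ 'a"
  where "vec_left z = (\<chi> i. z $ Inl i)"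

definition vec_right :: "'c ^ ('a::finite + 'b::finite) \<Rightarrow> 'c ^ 'b"
  where "vec_right z = (\<chi> j. z $ Inr j)"

lemma vec_left_join [simp]: "vec_left (vec_join u v) = u"
  and vec_right_join [simp]: "vec_right (vec_join u v) = v"
  by (simp_all add: vec_left_def vec_right_def vec_join_def vec_eq_iff)

lemma vec_join_left_right [simp]: "vec_join (vec_left z) (vec_right z) = z"
  by (simp add: vec_left_def vec_right_def vec_join_def vec_eq_iff split: sum.splits)

lemma vec_join_0_0 [simp]: "vec_join 0 0 = 0"
  by (simp add: vec_join_def vec_eq_iff split: sum.splits)

lemma linear_vec_left: "linear (vec_left :: real ^ ('a::finite + 'b::finite) \<Rightarrow> real ^ 'a)"
  and linear_vec_right: "linear (vec_right :: real ^ ('a::finite + 'b::finite) \<Rightarrow> real ^ 'b)"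
  by (auto intro!: linearI simp: vec_left_def vec_right_def vec_eq_iff)

lemma linear_vec_join:
  "linear (\<lambda>p. vec_join (fst p) (snd p) :: real ^ ('a::finite + 'b::finite))"
  by (auto intro!: linearI simp: vec_join_def vec_eq_iff split: sum.splits)

lemmas bounded_linear_vec_left = linear_vec_left[unfolded linear_conv_bounded_linear]
lemmas bounded_linear_vec_right = linear_vec_right[unfolded linear_conv_bounded_linear]

lemma vec_left_axis [simp]:
  "vec_left (axis (Inl i) c) = axis i c" "vec_left (axis (Inr j) c) = 0"
  and vec_right_axis [simp]:
  "vec_right (axis (Inl i) c) = 0" "vec_right (axis (Inr j) c) = axis j c"
  by (auto simp: vec_left_def vec_right_def axis_def vec_eq_iff)

lemma Basis_vec_sum_cases:
  assumes "e \<in> (Basis :: (real ^ ('a::finite + 'b::finite)) set)"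
  obtains i where "e = axis (Inl i) 1" | j where "e = axis (Inr j) 1"
proof -
  from assms obtain k where "e = axis k 1" by (auto simp: Basis_vec_def)
  with that show thesis by (cases k) auto
qed

lemma has_derivative_vec_join:
  assumes "(f has_derivative f') (at x within S)" and "(g has_derivative g') (at x within S)"
  shows "((\<lambda>x. vec_join (f x) (g x) :: real ^ ('a::finite + 'b::finite)) has_derivative
    (\<lambda>v. vec_join (f' v) (g' v))) (at x within S)"
  using bounded_linear.has_derivative
    [OF linear_vec_join[unfolded linear_conv_bounded_linear] has_derivative_Pair[OF assms]]
  by simp

lemma continuous_on_vec_join:
  assumes "continuous_on S f" and "continuous_on S g"
  shows "continuous_on S (\<lambda>x. vec_join (f x) (g x) :: real ^ ('a::finite + 'b::finite))"
  using bounded_linear.continuous_on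
    [OF linear_vec_join[unfolded linear_conv_bounded_linear] continuous_on_Pair[OF assms]]
  by simp

section \<open>Directional derivatives\<close>

lemma has_derivative_dir_deriv:
  "f differentiable (at x) \<Longrightarrow> (f has_derivative (\<lambda>v. dir_deriv v f x)) (at x)"
  by (simp add: dir_deriv_def frechet_derivative_works)

lemma dir_deriv_eq: "(f has_derivative D) (at x) \<Longrightarrow> dir_deriv v f x = D v"
  by (simp add: dir_deriv_def frechet_derivative_at[symmetric])

lemma dir_deriv_const [simp]: "dir_deriv v (\<lambda>_. c) = (\<lambda>_. 0)"
  by (rule ext) (rule dir_deriv_eq, rule has_derivative_const)

lemma dir_deriv_zero:
  assumes "\<And>x. f differentiable (at x)"
  shows "dir_deriv 0 f = (\<lambda>_. 0)"
proof
  fix x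
  from linear_0[OF has_derivative_linear[OF has_derivative_dir_deriv[OF assms]]]
  show "dir_deriv 0 f x = 0" .
qed

lemma C_k_zero: "C_k k (\<lambda>_. 0)"
  by (induction k) auto

section \<open>Maps in block form\<close>

definition block_map ::
    "(real ^ 'a \<Rightarrow> real ^ 'p) \<Rightarrow> (real ^ 'b \<Rightarrow> real ^ 'q) \<Rightarrow> ((real ^ 'a) \<times> (real ^ 'b) \<Rightarrow> real ^ 'r)
      \<Rightarrow> real ^ ('a + 'b) \<Rightarrow> real ^ ('p + 'q + 'r)"
  where "block_map f g h z =
    vec_join (f (vec_left z)) (vec_join (g (vec_right z)) (h (vec_left z, vec_right z)))"

lemma has_derivative_block_map:
  assumes "(f has_derivative f') (at (vec_left z))"
    and "(g has_derivative g') (at (vec_right z))"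
    and "(h has_derivative h') (at (vec_left z, vec_right z))"
  shows "(block_map f g h has_derivative block_map f' g' h') (at z)"
proof -
  have l: "(vec_left has_derivative vec_left) (at z)"
    and r: "(vec_right has_derivative vec_right) (at z)"
    by (simp_all add: bounded_linear_imp_has_derivative bounded_linear_vec_left
        bounded_linear_vec_right)
  show ?thesis
    unfolding block_map_def
    by (intro has_derivative_vec_join has_derivative_compose[OF l assms(1)]
        has_derivative_compose[OF r assms(2)]
        has_derivative_compose[OF has_derivative_Pair[OF l r] assms(3)])
qed

text \<open>Block form is stable under differentiation; this is what reduces every statement about
  the derivatives of a map in block form to its three blocks.\<close>

lemma dir_deriv_block_map:
  assumes "\<And>x. f differentiable (at x)" and "\<And>y. g differentiable (at y)"
    and "\<And>p. h differentiable (at p)"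
  shows "dir_deriv w (block_map f g h) =
    block_map (dir_deriv (vec_left w) f) (dir_deriv (vec_right w) g)
      (dir_deriv (vec_left w, vec_right w) h)"
proof
  fix z
  show "dir_deriv w (block_map f g h) z =
    block_map (dir_deriv (vec_left w) f) (dir_deriv (vec_right w) g)
      (dir_deriv (vec_left w, vec_right w) h) z"
    using dir_deriv_eq[OF has_derivative_block_map[OF has_derivative_dir_deriv
          has_derivative_dir_deriv has_derivative_dir_deriv], OF assms]
    by (simp add: block_map_def)
qed

lemma continuous_on_block_map:
  assumes "continuous_on UNIV f" and "continuous_on UNIV g" and "continuous_on UNIV h"
  shows "continuous_on UNIV (block_map f g h)"
proof -
  note l = linear_continuous_on[OF bounded_linear_vec_left]
    and r = linear_continuous_on[OF bounded_linear_vec_right]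
  show ?thesis
    unfolding block_map_def
    by (intro continuous_on_vec_join continuous_on_compose2[OF assms(1) l]
        continuous_on_compose2[OF assms(2) r]
        continuous_on_compose2[OF assms(3) continuous_on_Pair[OF l r]]) auto
qed

text \<open>A basis direction of the product is a basis direction of one factor and zero in the other,
  so each block of a first derivative is a basis derivative or vanishes identically. In either case
  it is again of class \<open>C\<^sup>k\<close>, and the induction hypothesis applies to the differentiated blocks.\<close>

lemma C_k_block_map:
  "C_k k f \<Longrightarrow> C_k k g \<Longrightarrow> C_k k h \<Longrightarrow> C_k k (block_map f g h)"
proof (induction k arbitrary: f g h)
  case 0
  then show ?case by (simp add: continuous_on_block_map)
next
  case (Suc k)
  then have df: "\<And>x. f differentiable (at x)" and dg: "\<And>y. g differentiable (at y)"
    and dh: "\<And>p. h differentiable (at p)"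
    by auto
  have "C_k k (dir_deriv e (block_map f g h))" if "e \<in> Basis" for e
    using that
  proof (cases rule: Basis_vec_sum_cases)
    case (1 i)
    have "C_k k (dir_deriv (axis i 1) f)" "C_k k (dir_deriv (axis i 1, 0) h)"
      using Suc.prems by (auto simp: Basis_prod_def axis_in_Basis_iff)
    then show ?thesis
      unfolding 1
      by (simp add: dir_deriv_block_map df dg dh dir_deriv_zero Suc.IH C_k_zero)
  next
    case (2 j)
    have "C_k k (dir_deriv (axis j 1) g)" "C_k k (dir_deriv (0, axis j 1) h)"
      using Suc.prems by (auto simp: Basis_prod_def axis_in_Basis_iff)
    then show ?thesis
      unfolding 2
      by (simp add: dir_deriv_block_map df dg dh dir_deriv_zero Suc.IH C_k_zero)
  qed
  moreover have "block_map f g h differentiable (at z)" for z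
    using has_derivative_block_map[OF has_derivative_dir_deriv
          has_derivative_dir_deriv has_derivative_dir_deriv, OF df dg dh]
    by (rule differentiableI)
  ultimately show ?case by simp
qed

section \<open>The jet of a map in block form\<close>

text \<open>Coefficients attached to indices, unlike those attached to the vectors, can be restricted
  to the blocks of the index set; a repeated vector is excluded by the same criterion.\<close>

lemma lin_indep_family_iff:
  assumes "finite I"
  shows "lin_indep_family I v \<longleftrightarrow>
    (\<forall>c. (\<Sum>k\<in>I. c k *\<^sub>R v k) = 0 \<longrightarrow> (\<forall>k\<in>I. c k = 0))"
proof
  assume l: "lin_indep_family I v"
  then have inj: "inj_on v I" and ind: "independent (v ` I)"
    by (auto simp: lin_indep_family_def)
  show "\<forall>c. (\<Sum>k\<in>I. c k *\<^sub>R v k) = 0 \<longrightarrow> (\<forall>k\<in>I. c k = 0)"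
  proof (intro allI impI ballI)
    fix c k
    assume "(\<Sum>k\<in>I. c k *\<^sub>R v k) = 0" and k: "k \<in> I"
    then have "(\<Sum>w\<in>v ` I. c (the_inv_into I v w) *\<^sub>R w) = 0"
      by (simp add: sum.reindex[OF inj] the_inv_into_f_f[OF inj])
    with independentD[OF ind _ subset_refl, of "\<lambda>w. c (the_inv_into I v w)" "v k"] assms k
    have "c (the_inv_into I v (v k)) = 0"
      by simp
    then show "c k = 0" by (simp add: the_inv_into_f_f[OF inj k])
  qed
next
  assume *: "\<forall>c. (\<Sum>k\<in>I. c k *\<^sub>R v k) = 0 \<longrightarrow> (\<forall>k\<in>I. c k = 0)"
  have inj: "inj_on v I"
  proof (rule inj_onI, rule ccontr)
    fix k l
    assume kl: "k \<in> I" "l \<in> I" "v k = v l" "k \<noteq> l"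
    \<comment> \<open>A repetition is the nontrivial relation \<open>v k - v l = 0\<close>.\<close>
    define c :: "'a \<Rightarrow> real" where "c m = (if m = k then 1 else 0) - (if m = l then 1 else 0)" for m
    have "(\<Sum>m\<in>I. c m *\<^sub>R v m) =
      (\<Sum>m\<in>I. if m = k then v m else 0) - (\<Sum>m\<in>I. if m = l then v m else 0)"
      unfolding c_def sum_subtractf[symmetric] by (rule sum.cong) auto
    also have "\<dots> = 0"
      using kl assms by simp
    finally have "c k = 0" using * kl by blast
    with kl show False by (simp add: c_def)
  qed
  moreover have "independent (v ` I)"
  proof (rule independent_if_scalars_zero)
    show "finite (v ` I)" using assms by simp
    fix c w
    assume "(\<Sum>x\<in>v ` I. c x *\<^sub>R x) = 0" and "w \<in> v ` I"
    with *[rule_format, of "\<lambda>k. c (v k)"] show "c w = 0"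
      by (auto simp: sum.reindex[OF inj])
  qed
  ultimately show "lin_indep_family I v" by (simp add: lin_indep_family_def)
qed

text \<open>On the ordered sum, where the left summand comes first, the second-order indices
  \<open>\<alpha> \<le> \<beta>\<close> with \<open>\<alpha>\<close> and \<open>\<beta>\<close> on different sides are exactly the pairs
  \<open>(Inl i, Inr j)\<close>; these are the indices of the mixed Hessian.\<close>

lemma jet_index_sum:
  "(jet_index :: (('a::linorder + 'b::linorder) + ('a + 'b) \<times> ('a + 'b)) set) =
    map_sum Inl (map_prod Inl Inl) ` jet_index \<union> map_sum Inr (map_prod Inr Inr) ` jet_index
      \<union> range (\<lambda>(i, j). Inr (Inl i, Inr j))"
  (is "?L = ?R")
proof
  show "?L \<subseteq> ?R"
  proof
    fix k :: "('a + 'b) + ('a + 'b) \<times> ('a + 'b)"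
    assume "k \<in> ?L"
    then consider (l) i where "k = Inl (Inl i)" | (r) j where "k = Inl (Inr j)"
      | (ll) i i' where "k = Inr (Inl i, Inl i')" "i \<le> i'"
      | (rr) j j' where "k = Inr (Inr j, Inr j')" "j \<le> j'"
      | (lr) i j where "k = Inr (Inl i, Inr j)"
    proof (cases k)
      case (Inl s)
      then show ?thesis using that(1,2) by (cases s) simp_all
    next
      case (Inr p)
      with \<open>k \<in> ?L\<close> obtain s t where "k = Inr (s, t)" "s \<le> t"
        by (auto simp: jet_index_def)
      then show ?thesis
        using that(3-5) by (cases s; cases t) (simp_all add: less_eq_sum_def)
    qed
    then show "k \<in> ?R"
    proof cases
      case l
      then have "k = map_sum Inl (map_prod Inl Inl) (Inl i)" by simp
      then show ?thesis unfolding jet_index_def by blast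
    next
      case r
      then have "k = map_sum Inr (map_prod Inr Inr) (Inl j)" by simp
      then show ?thesis unfolding jet_index_def by blast
    next
      case ll
      then have "k = map_sum Inl (map_prod Inl Inl) (Inr (i, i'))" by simp
      with ll show ?thesis unfolding jet_index_def by blast
    next
      case rr
      then have "k = map_sum Inr (map_prod Inr Inr) (Inr (j, j'))" by simp
      with rr show ?thesis unfolding jet_index_def by blast
    next
      case lr
      then show ?thesis by auto
    qed
  qed
  show "?R \<subseteq> ?L"
    by (auto simp: jet_index_def less_eq_sum_def)
qed

lemma sum_jet_index_sum:
  fixes u :: "('a::{finite,linorder} + 'b::{finite,linorder}) + ('a + 'b) \<times> ('a + 'b) \<Rightarrow> 'v::comm_monoid_add"
  shows "(\<Sum>k\<in>jet_index. u k) =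
    (\<Sum>k\<in>jet_index. u (map_sum Inl (map_prod Inl Inl) k)) +
    (\<Sum>k\<in>jet_index. u (map_sum Inr (map_prod Inr Inr) k)) +
    (\<Sum>(i, j)\<in>UNIV. u (Inr (Inl i, Inr j)))"
proof -
  let ?l = "map_sum Inl (map_prod Inl Inl) :: 'a + 'a \<times> 'a \<Rightarrow> ('a + 'b) + ('a + 'b) \<times> ('a + 'b)"
  let ?r = "map_sum Inr (map_prod Inr Inr) :: 'b + 'b \<times> 'b \<Rightarrow> ('a + 'b) + ('a + 'b) \<times> ('a + 'b)"
  let ?m = "\<lambda>(i, j). Inr (Inl i, Inr j) :: ('a + 'b) + ('a + 'b) \<times> ('a + 'b)"
  have inj: "inj_on ?l A" "inj_on ?r B" "inj ?m" for A B
    by (auto intro!: inj_onI sum.inj_map prod.inj_map simp: inj_def map_sum_def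
        split: sum.splits)
  have disj: "?l ` A \<inter> ?r ` B = {}" "(?l ` A \<union> ?r ` B) \<inter> range ?m = {}" for A B
    by (auto simp: map_sum_def split: sum.splits)
  have "sum u jet_index =
    sum u (?l ` jet_index) + sum u (?r ` jet_index) + sum u (range ?m)"
    unfolding jet_index_sum by (simp only: sum.union_disjoint disj finite)
  then show ?thesis
    by (simp only: sum.reindex inj) (simp add: comp_def case_prod_unfold)
qed

text \<open>The block triangular form of the 2-jet. The \<open>h\<close>-components of the pure derivatives are left
  open: they lie off the diagonal of the block matrix, so they do not affect independence.\<close>

lemma jet_block_map:
  assumes "C_k 2 f" and "C_k 2 g" and "C_k 2 h"
  shows "vec_left (jet (block_map f g h) z (map_sum Inl (map_prod Inl Inl) k)) =
      jet f (vec_left z) k"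
    and "vec_left (vec_right (jet (block_map f g h) z (map_sum Inl (map_prod Inl Inl) k))) = 0"
    and "vec_left (jet (block_map f g h) z (map_sum Inr (map_prod Inr Inr) l)) = 0"
    and "vec_left (vec_right (jet (block_map f g h) z (map_sum Inr (map_prod Inr Inr) l))) =
      jet g (vec_right z) l"
    and "jet (block_map f g h) z (Inr (Inl i, Inr j)) =
      vec_join 0 (vec_join 0
        (dir_deriv (axis i 1, 0) (dir_deriv (0, axis j 1) h) (vec_left z, vec_right z)))"
proof -
  have d: "\<And>x. f differentiable (at x)" "\<And>y. g differentiable (at y)"
      "\<And>p. h differentiable (at p)"
    using assms by (auto simp: numeral_2_eq_2)
  have d2: "\<And>i x. dir_deriv (axis i 1) f differentiable (at x)"
      "\<And>j y. dir_deriv (axis j 1) g differentiable (at y)"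
      "\<And>i p. dir_deriv (axis i 1, 0) h differentiable (at p)"
      "\<And>j p. dir_deriv (0, axis j 1) h differentiable (at p)"
    using assms by (auto simp: numeral_2_eq_2 Basis_prod_def axis_in_Basis_iff)
  note rules = jet_def dir_deriv_block_map d d2 dir_deriv_zero
  show "vec_left (jet (block_map f g h) z (map_sum Inl (map_prod Inl Inl) k)) =
      jet f (vec_left z) k"
    and "vec_left (vec_right (jet (block_map f g h) z (map_sum Inl (map_prod Inl Inl) k))) = 0"
    by (cases k; simp add: rules case_prod_unfold; simp add: block_map_def)+
  show "vec_left (jet (block_map f g h) z (map_sum Inr (map_prod Inr Inr) l)) = 0"
    and "vec_left (vec_right (jet (block_map f g h) z (map_sum Inr (map_prod Inr Inr) l))) =
      jet g (vec_right z) l"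
    by (cases l; simp add: rules case_prod_unfold; simp add: block_map_def)+
  show "jet (block_map f g h) z (Inr (Inl i, Inr j)) =
      vec_join 0 (vec_join 0
        (dir_deriv (axis i 1, 0) (dir_deriv (0, axis j 1) h) (vec_left z, vec_right z)))"
    by (simp add: rules) (simp add: block_map_def)
qed

text \<open>Block triangular elimination: the \<open>f\<close>- and \<open>g\<close>-components determine the coefficients of
  the pure derivatives. Only then does the \<open>h\<close>-component, to which the pure derivatives also
  contribute, reduce to the mixed Hessian.\<close>

lemma lin_indep_jet_block_map:
  fixes f :: "real ^ ('a::{finite,linorder}) \<Rightarrow> real ^ 'p"
    and g :: "real ^ ('b::{finite,linorder}) \<Rightarrow> real ^ 'q"
    and h :: "(real ^ ('a::{finite,linorder})) \<times> (real ^ ('b::{finite,linorder})) \<Rightarrow> real ^ 'r"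
  assumes C: "C_k 2 f" "C_k 2 g" "C_k 2 h"
    and f: "lin_indep_family jet_index (jet f (vec_left z))"
    and g: "lin_indep_family jet_index (jet g (vec_right z))"
    and h: "inj (mixed_hessian h (vec_left z, vec_right z))"
  shows "lin_indep_family jet_index (jet (block_map f g h) z)"
proof -
  let ?J = "jet (block_map f g h) z"
  let ?l = "map_sum Inl (map_prod Inl Inl) :: 'a + 'a \<times> 'a \<Rightarrow> ('a + 'b) + ('a + 'b) \<times> ('a + 'b)"
  let ?r = "map_sum Inr (map_prod Inr Inr) :: 'b + 'b \<times> 'b \<Rightarrow> ('a + 'b) + ('a + 'b) \<times> ('a + 'b)"
  note lin = linear_vec_left linear_vec_right
  have "c k = 0" if c: "(\<Sum>k\<in>jet_index. c k *\<^sub>R ?J k) = 0" and k: "k \<in> jet_index" for c k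
  proof -
    note jet = jet_block_map[OF C]
    have split: "(\<Sum>k\<in>jet_index. c (?l k) *\<^sub>R ?J (?l k)) +
      (\<Sum>k\<in>jet_index. c (?r k) *\<^sub>R ?J (?r k)) +
      (\<Sum>(i, j)\<in>UNIV. c (Inr (Inl i, Inr j)) *\<^sub>R ?J (Inr (Inl i, Inr j))) = 0"
      using c by (simp add: sum_jet_index_sum)
    have "(\<Sum>k\<in>jet_index. c (?l k) *\<^sub>R jet f (vec_left z) k) = 0"
      using arg_cong[OF split, of vec_left]
      by (simp add: linear_add[OF lin(1)] linear_sum[OF lin(1)] linear_scale[OF lin(1)]
          linear_0[OF lin(1)] jet case_prod_unfold)
    then have l: "c (?l k) = 0" if "k \<in> jet_index" for k
      using f that by (auto simp: lin_indep_family_iff)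
    have "(\<Sum>k\<in>jet_index. c (?r k) *\<^sub>R jet g (vec_right z) k) = 0"
      using arg_cong[OF split, of "\<lambda>w. vec_left (vec_right w)"]
      by (simp add: linear_add[OF lin(1)] linear_sum[OF lin(1)] linear_scale[OF lin(1)]
          linear_0[OF lin(1)] linear_add[OF lin(2)] linear_sum[OF lin(2)]
          linear_scale[OF lin(2)] linear_0[OF lin(2)] jet case_prod_unfold)
    then have r: "c (?r k) = 0" if "k \<in> jet_index" for k
      using g that by (auto simp: lin_indep_family_iff)
    define w :: "real ^ ('a \<times> 'b)" where "w = (\<chi> k. c (Inr (Inl (fst k), Inr (snd k))))"
    have "mixed_hessian h (vec_left z, vec_right z) w = 0"
      using arg_cong[OF split, of "\<lambda>w. vec_right (vec_right w)"]
      by (simp add: l r linear_sum[OF lin(2)] linear_scale[OF lin(2)] linear_0[OF lin(2)]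
          jet case_prod_unfold mixed_hessian_def w_def)
    also have "0 = mixed_hessian h (vec_left z, vec_right z) 0"
      by (simp add: mixed_hessian_def)
    finally have "w = 0"
      using h by (simp add: inj_eq)
    have m: "c (Inr (Inl i, Inr j)) = 0" for i j
      using arg_cong[OF \<open>w = 0\<close>, of "\<lambda>w. w $ (i, j)"] by (simp add: w_def)
    show "c k = 0"
      using k[unfolded jet_index_sum]
    proof (elim UnE imageE)
      fix k'
      assume "k = (\<lambda>(i, j). Inr (Inl i, Inr j)) k'"
      then show ?thesis by (cases k') (simp add: m)
    qed (simp_all only: l r)
  qed
  then show ?thesis by (simp add: lin_indep_family_iff)
qed

section \<open>Free maps on a product torus\<close>

lemma torus_proj_split:
  "torus_proj z = torus_join (torus_proj (vec_left z)) (torus_proj (vec_right z))"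
  by (simp add: torus_join.abs_eq)

lemma torus_lift_block_map:
  assumes "\<And>x y. F (torus_join x y) = vec_join (f x) (vec_join (g y) (h (x, y)))"
  shows "torus_lift F = block_map (torus_lift f) (torus_lift g) (torus_lift2 h)"
proof
  fix z
  show "torus_lift F z = block_map (torus_lift f) (torus_lift g) (torus_lift2 h) z"
    using assms[of "torus_proj (vec_left z)" "torus_proj (vec_right z)"]
    by (simp add: torus_lift_def torus_lift2_def block_map_def torus_proj_split[of z])
qed

text \<open>The identity is \<open>(a + b) * (a + b + 3) = a * (a + 3) + b * (b + 3) + 2 * a * b\<close>;
  halving it is legitimate because \<open>m * (m + 3)\<close> is even.\<close>

lemma q_dim_add: "q_dim (a + b) = q_dim a + q_dim b + a * b"
proof -
  have double: "2 * q_dim m = m * (m + 3)" for m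
    unfolding q_dim_def by (rule dvd_mult_div_cancel) auto
  have "2 * q_dim (a + b) = 2 * (q_dim a + q_dim b + a * b)"
    by (simp add: double distrib_left) (simp add: algebra_simps)
  then show ?thesis by simp
qed

theorem lemma4:
  fixes f :: "'a::{finite,linorder} torus \<Rightarrow> real ^ 'p"
    and g :: "'b::{finite,linorder} torus \<Rightarrow> real ^ 'q"
    and h :: "'a torus \<times> 'b torus \<Rightarrow> real ^ 'r"
    and F :: "('a + 'b) torus \<Rightarrow> real ^ ('p + 'q + 'r)"
  assumes "CARD('p) = q_dim CARD('a)"
    and "CARD('q) = q_dim CARD('b)"
    and "CARD('r) = CARD('a) * CARD('b)"
    and "(cross_free_maps :: ('a torus \<times> 'b torus \<Rightarrow> real ^ 'r) set) \<noteq> {}"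
    and "(Free_infinity :: ('a torus \<Rightarrow> real ^ 'p) set) \<noteq> {}"
    and "(Free_infinity :: ('b torus \<Rightarrow> real ^ 'q) set) \<noteq> {}"
    and "f \<in> Free_infinity"
    and "g \<in> Free_infinity"
    and "h \<in> cross_free_maps"
    and "\<And>x y. F (torus_join x y) = vec_join (f x) (vec_join (g y) (h (x, y)))"
  shows "CARD('p + 'q + 'r) = q_dim CARD('a + 'b) \<and> F \<in> Free_infinity"
proof
  show "CARD('p + 'q + 'r) = q_dim CARD('a + 'b)"
    using assms(1-3) by (simp add: q_dim_add)
  have f: "C_k k (torus_lift f)" "lin_indep_family jet_index (jet (torus_lift f) x)"
    and g: "C_k k (torus_lift g)" "lin_indep_family jet_index (jet (torus_lift g) y)"
    for k x y
    using assms(7,8) by (auto simp: Free_infinity_def free_map_def C_infinity_def)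
  have h: "C_k k (torus_lift2 h)" "inj (mixed_hessian (torus_lift2 h) p)" for k p
    using assms(9) by (cases p, auto simp: cross_free_maps_def C_infinity_def bij_is_inj)+
  have F: "torus_lift F = block_map (torus_lift f) (torus_lift g) (torus_lift2 h)"
    by (rule torus_lift_block_map) (rule assms(10))
  show "F \<in> Free_infinity"
    unfolding Free_infinity_def free_map_def C_infinity_def F
    by (simp add: C_k_block_map lin_indep_jet_block_map f g h F)
qed

end
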